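(* Let $k>0$ be a fixed integer and let $F$ be a distribution function on $\mathbb{R}$. (i) Let $p\in(0,1)$, $a=\frac1p$ and $c>0$. The stationary max-AR(1) model with parameters $(p,c,k)$, under the assumption $\epsilon_{i,1}=Y_{i,0}$ (in distribution), holds with $F$ as the distribution function of the $Y_{i,n}$ if and only if $F$ is Harris($a,c,k$)-max-semi-stable. (ii) Under the same assumption, the stationary max-AR(1) model holds with $F$ as the distribution function of the $Y_{i,n}$ for every $p\in(0,1)$ (with some $c=c(p)>0$) if and only if $F$ is Harris($a,k$)-max-stable.
   Context: The max-AR(1) model with parameters $(p,c,k)$, where $p\in(0,1)$, $c>0$ and $k$ is a fixed positive integer: $\{Y_{i,n}\}$, $i=1,\dots,k$, are i.i.d. random variables for each $n$, the innovations $\{\epsilon_{i,n}\}$, $i=1,\dots,k$, are i.i.d. random variables, with $\epsilon_{1,n},\dots,\epsilon_{k,n}$ independent of $Y_{1,n-1},\dots,Y_{k,n-1}$, and $$\bigvee_{i=1}^{k} Y_{i,n}=\begin{cases}\bigvee_{i=1}^{k}\frac1c Y_{i,n-1}, & \text{with probability } p,\\[4pt] \left\{\bigvee_{i=1}^{k}\frac1c Y_{i,n-1}\right\}\bigvee\left\{\bigvee_{i=1}^{k}\epsilon_{i,n}\right\}, & \text{with probability } 1-p,\end{cases}$$ where $\bigvee$ denotes maximum and the choice between the two cases is independent of the $Y_{i,n-1}$ and $\epsilon_{i,n}$. Stationarity means that the distribution of $Y_{i,n}$ does not depend on $n$. Saying that the stationary model holds with $F$ as the distribution function of the $Y_{i,n}$,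 under the assumption $\epsilon_{i,1}=Y_{i,0}$ in distribution, means: when $Y_{1,n-1},\dots,Y_{k,n-1},\epsilon_{1,n},\dots,\epsilon_{k,n}$ are all independent with distribution function $F$, the right-hand side of the displayed relation has distribution function $F^k$, that is, $F^k(x)=pF^k(cx)+(1-p)F^k(cx)F^k(x)$ for all $x\in\mathbb{R}$. Write $F^k(x)=\frac{1}{1+\psi(x)}$ with $\psi:\mathbb{R}\to[0,\infty]$, where $\psi(x)=\infty$ exactly when $F(x)=0$, and $a\cdot\infty=\infty$. The distribution function $F=\left\{\frac1{1+\psi}\right\}^{1/k}$ is called Harris($a,c,k$)-max-semi-stable if $0<c<1<a$ and $\psi(x)=a\,\psi(cx)$ for all $x\in\mathbb{R}$. It is called Harris($a,k$)-max-stable if for every $a>1$ there is $c=c(a)$ such that it is Harris($a,c,k$)-max-semi-stable.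
   Formalization: In (i) and (ii) c ranges over (0,1) instead of c>0: as written the claim fails, e.g. for k=1, F(x)=x/(1+x) on x>0, which satisfies the model with c=1/p>1 for every p but is not Harris-max-semi-stable, whose definition requires c<1. *)

theory Defs
  imports "HOL-Probability.Probability"
begin

definition distribution_function :: "(real \<Rightarrow> real) \<Rightarrow> bool" where
  "distribution_function F \<longleftrightarrow>
     mono F \<and> (\<forall>x. continuous (at_right x) F) \<and>
     (F \<longlongrightarrow> 0) at_bot \<and> (F \<longlongrightarrow> 1) at_top"

(* The joint law of the inputs (b, y, e) of one step: b is True with probability p, y 1, ..., y k
   are the values at time n - 1 and e 1, ..., e k the innovations at time n, all independent and
   the y i and e i with distribution function F (whose law is interval_measure F). *)
definition max_AR1_input ::
    "real \<Rightarrow> nat \<Rightarrow> (real \<Rightarrow> real) \<Rightarrow> (bool \<times> (nat \<Rightarrow> real) \<times> (nat \<Rightarrow> real)) measure" where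
  "max_AR1_input p k F =
     measure_pmf (bernoulli_pmf p) \<Otimes>\<^sub>M
       ((\<Pi>\<^sub>M i\<in>{1..k}. interval_measure F) \<Otimes>\<^sub>M (\<Pi>\<^sub>M i\<in>{1..k}. interval_measure F))"

definition max_AR1_update ::
    "real \<Rightarrow> nat \<Rightarrow> bool \<times> (nat \<Rightarrow> real) \<times> (nat \<Rightarrow> real) \<Rightarrow> real" where
  "max_AR1_update c k = (\<lambda>(b, y, e).
     if b then (MAX i\<in>{1..k}. 1 / c * y i)
     else max (MAX i\<in>{1..k}. 1 / c * y i) (MAX i\<in>{1..k}. e i))"

(* F x ^ k is the distribution function of the left-hand side of the recursion, the maximum of
   Y_{1,n}, ..., Y_{k,n} when these are i.i.d. with distribution function F. *)
definition stationary_max_AR1 :: "real \<Rightarrow> real \<Rightarrow> nat \<Rightarrow> (real \<Rightarrow> real) \<Rightarrow> bool" where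
  "stationary_max_AR1 p c k F \<longleftrightarrow>
     (\<forall>x. cdf (distr (max_AR1_input p k F) borel (max_AR1_update c k)) x = F x ^ k)"

(* In ennreal, 1 / (1 + \<infinity>) = 0 and ennreal a * \<infinity> = \<infinity> for a > 0, so the first equation determines
   psi and forces psi x = \<infinity> exactly when F x = 0. *)
definition Harris_max_semi_stable :: "real \<Rightarrow> real \<Rightarrow> nat \<Rightarrow> (real \<Rightarrow> real) \<Rightarrow> bool" where
  "Harris_max_semi_stable a c k F \<longleftrightarrow>
     0 < c \<and> c < 1 \<and> 1 < a \<and>
     (\<exists>psi :: real \<Rightarrow> ennreal.
        (\<forall>x. ennreal (F x ^ k) = 1 / (1 + psi x)) \<and>
        (\<forall>x. psi x = ennreal a * psi (c * x)))"

definition Harris_max_stable :: "nat \<Rightarrow> (real \<Rightarrow> real) \<Rightarrow> bool" where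
  "Harris_max_stable k F \<longleftrightarrow> (\<forall>a>1. \<exists>c. Harris_max_semi_stable a c k F)"

end

theory Submission
  imports Defs
begin

text \<open>
  Write \<open>G = F ^ k\<close>, the distribution function of the maximum of \<open>k\<close> independent variables with
  distribution function \<open>F\<close>. A maximum is at most \<open>x\<close> iff all its terms are, so by independence the
  updated maximum has distribution function \<open>p * G (c * x) + (1 - p) * G (c * x) * G x\<close>
  (\<open>cdf_max_AR1_update\<close>). Stationarity thus is a functional equation for \<open>G\<close>
  (\<open>stationary_max_AR1_iff\<close>), in which \<open>x\<close> occurs only through the two numbers \<open>g = G x\<close> and
  \<open>h = G (c * x)\<close>.

  The function \<open>psi\<close> with \<open>G = 1 / (1 + psi)\<close> makes this equation linear: for positive \<open>g\<close> and \<open>h\<close>,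
  dividing \<open>g = p * h + (1 - p) * h * g\<close> by \<open>g * h\<close> gives
  \<open>1 + psi (c * x) = p * (1 + psi x) + (1 - p)\<close>, that is, \<open>psi x = (1 / p) * psi (c * x)\<close>. If \<open>g\<close> or
  \<open>h\<close> vanishes, either relation forces both to vanish, which is \<open>psi = \<infinity>\<close> at both points
  (\<open>functional_equation_iff_odds_scaling\<close>). This is the equivalence for a single \<open>p\<close>; the one for all
  \<open>p\<close> follows because \<open>p \<mapsto> 1 / p\<close> maps \<open>(0, 1)\<close> onto \<open>(1, \<infinity>)\<close>.
\<close>

section \<open>The functional equation in terms of the odds\<close>

lemma one_divide_one_plus_ennreal_cases:
  fixes q :: ennreal and g :: real
  assumes "ennreal g = 1 / (1 + q)" "0 \<le> g"
  shows "(q = \<top> \<and> g = 0) \<or> (\<exists>r\<ge>0. q = ennreal r \<and> g = 1 / (1 + r))"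
proof (cases q)
  case (real r)
  have "1 / (1 + q) = ennreal (1 / (1 + r))"
    using real divide_ennreal[of 1 "1 + r"] by (simp flip: ennreal_plus ennreal_1)
  with assms real show ?thesis by auto
next
  case top
  with assms show ?thesis by (auto simp: ennreal_eq_0_iff divide_ennreal_def)
qed

lemma exists_odds:
  fixes g :: real
  assumes "0 \<le> g" "g \<le> 1"
  shows "\<exists>q. ennreal g = 1 / (1 + q)"
proof (cases "g = 0")
  case True
  then show ?thesis by (intro exI[of _ \<top>]) (simp add: divide_ennreal_def)
next
  case False
  then have "1 / (1 + ennreal (1 / g - 1)) = 1 / ennreal (1 + (1 / g - 1))"
    using assms by (subst ennreal_plus) auto
  also have "\<dots> = ennreal g"
    using False assms divide_ennreal[of 1 "1 / g"] by simp
  finally show ?thesis by metis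
qed

text \<open>
  For finite odds \<open>s\<close> of \<open>g\<close> and \<open>t\<close> of \<open>h\<close> the two sides of the equation differ by
  \<open>g * h * (p * s - t)\<close>. Infinite odds mean \<open>g = 0\<close> or \<open>h = 0\<close>; as \<open>p > 0\<close>, both relations then say that
  \<open>g\<close> and \<open>h\<close> vanish together.
\<close>

lemma functional_equation_iff_odds_scaling:
  fixes p g h :: real and q r :: ennreal
  assumes p: "0 < p" and g: "0 \<le> g" "ennreal g = 1 / (1 + q)"
    and h: "0 \<le> h" "ennreal h = 1 / (1 + r)"
  shows "g = p * h + (1 - p) * h * g \<longleftrightarrow> q = ennreal (1 / p) * r"
proof -
  have a: "1 / p > 0" using p by simp
  consider (tt) "q = \<top>" "g = 0" "r = \<top>" "h = 0"
    | (tf) t where "q = \<top>" "g = 0" "t \<ge> 0" "r = ennreal t" "h = 1 / (1 + t)"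
    | (ft) s where "s \<ge> 0" "q = ennreal s" "g = 1 / (1 + s)" "r = \<top>" "h = 0"
    | (ff) s t where "s \<ge> 0" "q = ennreal s" "g = 1 / (1 + s)"
        "t \<ge> 0" "r = ennreal t" "h = 1 / (1 + t)"
    using one_divide_one_plus_ennreal_cases[OF g(2,1)] one_divide_one_plus_ennreal_cases[OF h(2,1)]
    by blast
  then show ?thesis
  proof cases
    case tt
    then show ?thesis using a by (simp add: ennreal_mult_top)
  next
    case tf
    have "p * h \<noteq> 0" using tf p by simp
    moreover have "ennreal (1 / p) * r \<noteq> \<top>" using tf a by (simp add: ennreal_mult[symmetric])
    ultimately show ?thesis using tf by auto
  next
    case ft
    then show ?thesis using a by (simp add: ennreal_mult_top)
  next
    case ff
    have "q = ennreal (1 / p) * r \<longleftrightarrow> s = t / p"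
      using ff a by (simp flip: ennreal_mult)
    also have "\<dots> \<longleftrightarrow> p * s - t = 0"
      using p by (auto simp: field_simps)
    also have "\<dots> \<longleftrightarrow> g * h * (p * s - t) = 0"
      using ff by auto
    also have "g * h * (p * s - t) = p * h + (1 - p) * h * g - g"
    proof -
      have gs: "g * s = 1 - g" and ht: "h * t = 1 - h" using ff by (simp_all add: field_simps)
      have "g * h * (p * s - t) = p * h * (g * s) - g * (h * t)" by (simp add: algebra_simps)
      also have "\<dots> = p * h + (1 - p) * h * g - g" unfolding gs ht by (simp add: algebra_simps)
      finally show ?thesis .
    qed
    finally show ?thesis by auto
  qed
qed

section \<open>The distribution function of the updated maximum\<close>

lemma measure_pair_Times:
  assumes "sigma_finite_measure N" "A \<in> sets M" "B \<in> sets N"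
  shows "measure (M \<Otimes>\<^sub>M N) (A \<times> B) = measure M A * measure N B"
  using sigma_finite_measure.emeasure_pair_measure_Times[OF assms]
  by (simp add: measure_def enn2real_mult)

lemma measure_PiM_atMost:
  assumes "real_distribution M" "finite I"
  shows "measure (\<Pi>\<^sub>M i\<in>I. M) (I \<rightarrow>\<^sub>E {..x}) = cdf M x ^ card I"
proof -
  interpret real_distribution M by fact
  interpret finite_product_prob_space "\<lambda>_. M" I
    by (standard) (use \<open>finite I\<close> in auto)
  show ?thesis
    using prob_times[of "\<lambda>_. {..x}"] by (simp add: cdf_def)
qed

text \<open>
  The event splits according to the choice \<open>b\<close>: both the old values and, if \<open>b\<close> is false, the
  innovations range over boxes, so the event is a disjoint union of two rectangles.
\<close>

lemma max_AR1_update_le_eq: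
  assumes "k > 0" "c > 0"
  shows "{w \<in> space (max_AR1_input p k F). max_AR1_update c k w \<le> x} =
      {True} \<times> (({1..k} \<rightarrow>\<^sub>E {..c * x}) \<times> ({1..k} \<rightarrow>\<^sub>E UNIV)) \<union>
      {False} \<times> (({1..k} \<rightarrow>\<^sub>E {..c * x}) \<times> ({1..k} \<rightarrow>\<^sub>E {..x}))"
proof -
  have ne: "{1..k} \<noteq> {}" using assms(1) by simp
  have scale: "1 / c * y \<le> x \<longleftrightarrow> y \<le> c * x" for y
    using assms(2) by (simp add: field_simps)
  have "max_AR1_update c k (b, y, e) \<le> x \<longleftrightarrow>
      (\<forall>i\<in>{1..k}. y i \<le> c * x) \<and> (b \<or> (\<forall>i\<in>{1..k}. e i \<le> x))" for b y e
    unfolding max_AR1_update_def using ne by (simp add: scale del: times_divide_eq_left)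
  then show ?thesis
    unfolding max_AR1_input_def space_pair_measure space_PiM
    by (intro set_eqI, simp only: mem_Collect_eq split_paired_all)
      (auto simp: PiE_iff simp del: atLeastAtMost_iff)
qed

lemma cdf_max_AR1_update:
  assumes k: "k > 0" and c: "c > 0" and p: "0 \<le> p" "p \<le> 1" and F: "distribution_function F"
  shows "cdf (distr (max_AR1_input p k F) borel (max_AR1_update c k)) x =
    p * F (c * x) ^ k + (1 - p) * F (c * x) ^ k * F x ^ k"
proof -
  let ?M = "interval_measure F"
  let ?P = "\<Pi>\<^sub>M i\<in>{1..k}. ?M"
  let ?B = "measure_pmf (bernoulli_pmf p)"
  let ?box = "\<lambda>x. {1..k} \<rightarrow>\<^sub>E {..x}"
  note F' = F[unfolded distribution_function_def]
  have mono: "F x \<le> F y" if "x \<le> y" for x y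
    using F' that by (auto dest: monoD)
  have M: "real_distribution ?M"
    by (rule real_distribution_interval_measure) (use F' mono in auto)
  have cdf_M: "cdf ?M = F"
    by (rule cdf_interval_measure) (use F' mono in auto)
  interpret M: real_distribution ?M by fact
  interpret P: finite_product_prob_space "\<lambda>_. ?M" "{1..k}"
    by standard auto
  interpret PP: pair_prob_space ?P ?P ..
  interpret I: pair_prob_space ?B "?P \<Otimes>\<^sub>M ?P" ..
  have sf: "sigma_finite_measure ?P" "sigma_finite_measure (?P \<Otimes>\<^sub>M ?P)"
    by unfold_locales
  have box: "?box y \<in> sets ?P" for y
    by (intro sets_PiM_I_finite) auto
  have UN: "({1..k} \<rightarrow>\<^sub>E (UNIV :: real set)) = space ?P" "({1..k} \<rightarrow>\<^sub>E UNIV) \<in> sets ?P"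
    using sets.top[of ?P] by (simp_all add: space_PiM)
  have box_prob: "measure ?P (?box y) = F y ^ k" for y
    using measure_PiM_atMost[OF M, of "{1..k}"] by (simp add: cdf_M)
  have rect: "measure (max_AR1_input p k F) ({b} \<times> (A \<times> B)) =
      pmf (bernoulli_pmf p) b * (measure ?P A * measure ?P B)"
    if "A \<in> sets ?P" "B \<in> sets ?P" for b A B
    unfolding max_AR1_input_def using that
    by (simp add: measure_pair_Times sf measure_pmf_single del: One_nat_def)
  define R1 where "R1 y = {True} \<times> (?box (c * y) \<times> ({1..k} \<rightarrow>\<^sub>E (UNIV :: real set)))" for y
  define R2 where "R2 y = {False} \<times> (?box (c * y) \<times> ?box y)" for y
  have R: "R1 y \<in> sets (max_AR1_input p k F)" "R2 y \<in> sets (max_AR1_input p k F)" for y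
    unfolding R1_def R2_def max_AR1_input_def using box UN by auto
  have le: "{w \<in> space (max_AR1_input p k F). max_AR1_update c k w \<le> y} = R1 y \<union> R2 y" for y
    unfolding R1_def R2_def by (rule max_AR1_update_le_eq[OF k c])
  \<comment> \<open>Half-lines generate the Borel sets, so the same decomposition also gives measurability.\<close>
  have meas: "max_AR1_update c k \<in> borel_measurable (max_AR1_input p k F)"
    unfolding borel_measurable_iff_le le using R by auto
  have "cdf (distr (max_AR1_input p k F) borel (max_AR1_update c k)) x =
      measure (max_AR1_input p k F) {w \<in> space (max_AR1_input p k F). max_AR1_update c k w \<le> x}"
    unfolding cdf_def by (subst measure_distr[OF meas]) (auto intro!: arg_cong2[of _ _ _ _ measure])
  also have "\<dots> = measure (max_AR1_input p k F) (R1 x) + measure (max_AR1_input p k F) (R2 x)"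
    unfolding le using R I.finite_measure_Union[of "R1 x" "R2 x"]
    by (auto simp: max_AR1_input_def R1_def R2_def)
  also have "measure (max_AR1_input p k F) (R1 x) = p * F (c * x) ^ k"
    unfolding R1_def rect[OF box UN(2)] box_prob using p by (simp add: UN(1) prob_space.prob_space[OF P.prob_space_axioms] del: One_nat_def)
  also have "measure (max_AR1_input p k F) (R2 x) = (1 - p) * F (c * x) ^ k * F x ^ k"
    unfolding R2_def rect[OF box box] box_prob using p by simp
  finally show ?thesis .
qed

lemma stationary_max_AR1_iff:
  assumes "k > 0" "c > 0" "0 \<le> p" "p \<le> 1" "distribution_function F"
  shows "stationary_max_AR1 p c k F \<longleftrightarrow>
    (\<forall>x. F x ^ k = p * F (c * x) ^ k + (1 - p) * F (c * x) ^ k * F x ^ k)"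
  unfolding stationary_max_AR1_def cdf_max_AR1_update[OF assms] by (simp add: eq_commute)

section \<open>The characterisation\<close>

lemma distribution_function_bounds:
  assumes "distribution_function F"
  shows "0 \<le> F x" "F x \<le> 1"
proof -
  note F = assms[unfolded distribution_function_def]
  show "0 \<le> F x"
    using F by (intro tendsto_upperbound[of F 0 at_bot])
      (auto simp: eventually_at_bot_linorder dest: monoD intro!: exI[of _ x])
  show "F x \<le> 1"
    using F by (intro tendsto_lowerbound[of F 1 at_top])
      (auto simp: eventually_at_top_linorder dest: monoD intro!: exI[of _ x])
qed

lemma stationary_max_AR1_iff_Harris_max_semi_stable:
  assumes k: "k > 0" and F: "distribution_function F"
    and p: "0 < p" "p < 1" and c: "0 < c" "c < 1"
  shows "stationary_max_AR1 p c k F \<longleftrightarrow> Harris_max_semi_stable (1 / p) c k F"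
proof -
  have G: "0 \<le> F x ^ k" "F x ^ k \<le> 1" for x
    using distribution_function_bounds[OF F, of x] by (auto intro: power_le_one)
  have scaling: "(F x ^ k = p * F (c * x) ^ k + (1 - p) * F (c * x) ^ k * F x ^ k) \<longleftrightarrow>
      psi x = ennreal (1 / p) * psi (c * x)"
    if "\<forall>x. ennreal (F x ^ k) = 1 / (1 + psi x)" for psi x
    using functional_equation_iff_odds_scaling[OF p(1) G(1)[of x] _ G(1)[of "c * x"]] that by blast
  have "\<exists>psi. \<forall>x. ennreal (F x ^ k) = 1 / (1 + psi x)"
    using exists_odds[OF G] by (intro choice) blast
  \<comment> \<open>The scaling relation holds for some \<open>psi\<close> representing \<open>F ^ k\<close> iff it holds for each of them.\<close>
  then have "(\<forall>x. F x ^ k = p * F (c * x) ^ k + (1 - p) * F (c * x) ^ k * F x ^ k) \<longleftrightarrow>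
      (\<exists>psi. (\<forall>x. ennreal (F x ^ k) = 1 / (1 + psi x)) \<and> (\<forall>x. psi x = ennreal (1 / p) * psi (c * x)))"
    using scaling by (metis (no_types, lifting))
  then show ?thesis
    unfolding Harris_max_semi_stable_def
    using stationary_max_AR1_iff[OF k c(1) _ _ F, of p] p c by simp
qed

theorem theorem3p4:
  fixes k :: nat and F :: "real \<Rightarrow> real"
  assumes "k > 0" and "distribution_function F"
  shows "(\<forall>p a c :: real. 0 < p \<and> p < 1 \<and> a = 1 / p \<and> 0 < c \<and> c < 1 \<longrightarrow>
            (stationary_max_AR1 p c k F \<longleftrightarrow> Harris_max_semi_stable a c k F)) \<and>
         ((\<forall>p :: real. 0 < p \<and> p < 1 \<longrightarrow> (\<exists>c. 0 < c \<and> c < 1 \<and> stationary_max_AR1 p c k F)) \<longleftrightarrow>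
            Harris_max_stable k F)"
proof (intro conjI iffI)
  note single = stationary_max_AR1_iff_Harris_max_semi_stable[OF assms]
  show "\<forall>p a c :: real. 0 < p \<and> p < 1 \<and> a = 1 / p \<and> 0 < c \<and> c < 1 \<longrightarrow>
      (stationary_max_AR1 p c k F \<longleftrightarrow> Harris_max_semi_stable a c k F)"
    using single by blast
  show "Harris_max_stable k F"
    if all_p: "\<forall>p :: real. 0 < p \<and> p < 1 \<longrightarrow> (\<exists>c. 0 < c \<and> c < 1 \<and> stationary_max_AR1 p c k F)"
    unfolding Harris_max_stable_def
  proof (intro allI impI)
    fix a :: real assume "1 < a"
    then have "0 < 1 / a" "1 / a < 1" by auto
    moreover from this obtain c where "0 < c" "c < 1" "stationary_max_AR1 (1 / a) c k F"
      using all_p by blast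
    ultimately show "\<exists>c. Harris_max_semi_stable a c k F"
      using single[of "1 / a" c] by auto
  qed
  show "\<forall>p :: real. 0 < p \<and> p < 1 \<longrightarrow> (\<exists>c. 0 < c \<and> c < 1 \<and> stationary_max_AR1 p c k F)"
    if stable: "Harris_max_stable k F"
  proof (intro allI impI)
    fix p :: real assume p: "0 < p \<and> p < 1"
    then have "1 < 1 / p" by simp
    with stable obtain c where c: "Harris_max_semi_stable (1 / p) c k F"
      unfolding Harris_max_stable_def by blast
    then have "0 < c" "c < 1" by (auto simp: Harris_max_semi_stable_def)
    with c p single show "\<exists>c. 0 < c \<and> c < 1 \<and> stationary_max_AR1 p c k F" by blast
  qed
qed

end
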